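(* Let $(\Omega,\mathcal{F},\mathbb{P},\sigma)$ be a measure-preserving dynamical system. Let $f\in\mathcal{H}(\Omega)$ and let $F\in\tilde{\mathcal{H}}(\Omega)$ be the standard lift of $f$. Then, for each $x_0\in[0,1)$, $n\in\mathbb{N}$ and $\omega\in\Omega$, $$\left|\frac{1}{n}F^{(n)}_{\omega}(x_0)-B_f(n,\omega,x_0)\right|<\frac{1}{n},$$ and, for each $x_0\in[0,1)$ and for $\mathbb{P}$-almost every $\omega\in\Omega$, $$\lim_{n\to\infty}B_f(n,\omega,x_0)=\rho_F(\omega).$$
   Context: Circle and lifts. $S^1=\mathbb{R}/\mathbb{Z}$ is parametrized by $[0,1)$, and $\pi:\mathbb{R}\to S^1$ is $\pi(x)=x-\lfloor x\rfloor$. $\tilde{\mathcal{H}}$ is the set of increasing homeomorphisms $F:\mathbb{R}\to\mathbb{R}$ with $F(x+1)=F(x)+1$ for all $x$. $\mathcal{H}$ is the set of orientation-preserving homeomorphisms $f:S^1\to S^1$, i.e. those for which there is $F\in\tilde{\mathcal{H}}$ (a lift of $f$) with $\pi\circ F=f\circ\pi$; the lift is unique up to adding an integer. Put $\Delta_F(x)=F(x)-x$ and $\|\Delta_F\|=\sup_{x\in\mathbb{R}}|\Delta_F(x)|$. $\tilde{\mathcal{H}}$ carries the metric $\sup_x|F(x)-G(x)|$, and $\mathcal{H}$ the metric given by the infimum of this quantity over lifts $F$ of $f$ and $G$ of $g$; measurability of maps into these spaces is with respect to the Borel $\sigma$-algebras. Random circle homeomorphisms. A measure-preserving dynamical system $(\Omega,\mathcal{F},\mathbb{P},\sigma)$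 is a probability space with a measurable map $\sigma:\Omega\to\Omega$ (not assumed invertible or ergodic) such that $\mathbb{P}(\sigma^{-1}(A))=\mathbb{P}(A)$ for all $A\in\mathcal{F}$. $\mathcal{H}(\Omega)$ is the set of measurable maps $f:\Omega\to\mathcal{H}$, $\omega\mapsto f_\omega$. For $n\ge 1$, $f^{(n)}_\omega=f_{\sigma^{n-1}\omega}\circ\cdots\circ f_{\sigma\omega}\circ f_\omega$, and $f^{(0)}_\omega=\mathrm{Id}$. A measurable $F:\Omega\to\tilde{\mathcal{H}}$ is a lift of $f$ if $\pi\circ F_\omega=f_\omega\circ\pi$ for every $\omega$; $F^{(n)}_\omega$ is defined analogously. $\tilde{\mathcal{H}}(\Omega)$ is the set of measurable $F:\Omega\to\tilde{\mathcal{H}}$ with $\int_\Omega\|\Delta_{F_\omega}\|\,\mathrm{d}\mathbb{P}(\omega)<\infty$. The standard lift of $f$ is the unique lift $F$ with $F_\omega(0)\in[0,1)$ for each $\omega\in\Omega$. Random rotation number. For $F\in\tilde{\mathcal{H}}(\Omega)$, it is known (Li–Lu) that there is a function $\rho_F\in L^1(\Omega)$, the random rotation number, such that for each $x\in\mathbb{R}$, $\lim_{n\to\infty}\frac{F^{(n)}_\omega(x)-x}{n}=\rho_F(\omega)$ for $\mathbb{P}$-almost every $\omega$. Binary coding frequency. Let $\hat f_\omega:[0,1)\to[0,1)$ be $f_\omega$ regarded as a map of the interval $[0,1)$ (similarly $\hat f^{(k)}_\omega$ for $f^{(k)}_\omega$), and let $c_\omega=f_\omega^{-1}(0)\in[0,1)$.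 Let $J_\omega=[c_\omega,1)$ if $\hat f_\omega(0)\neq0$ and $J_\omega=\emptyset$ if $\hat f_\omega(0)=0$, and let $S_\omega=\chi_{J_\omega}:[0,1)\to\mathbb{R}$ be the indicator function of $J_\omega$. For $x_0\in[0,1)$, $\omega\in\Omega$, $n\in\mathbb{N}=\{1,2,\dots\}$, $$B_f(n,\omega,x_0)=\frac1n\sum_{k=0}^{n-1}S_{\sigma^k\omega}\bigl(\hat f^{(k)}_\omega(x_0)\bigr).$$ *)

theory Defs
  imports "HOL-Probability.Probability"
begin

section \<open>The circle\<close>

text \<open>
  The circle \<open>\<real>/\<int>\<close> is represented by its fundamental domain \<open>[0,1)\<close>; the projection
  \<open>\<real> \<rightarrow> \<real>/\<int>\<close> is \<^const>\<open>frac\<close>, and the topology is the quotient topology along it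
  (not the subspace topology of \<open>[0,1)\<close>).
\<close>

definition circle :: "real set" where
  "circle = {0..<1}"

definition circle_topology :: "real topology" where
  "circle_topology = topology (\<lambda>U. U \<subseteq> circle \<and> open (frac -` U))"

lemma frac_in_circle [simp]: "frac x \<in> circle"
  by (simp add: circle_def frac_lt_1)

lemma openin_circle_topology:
  "openin circle_topology U \<longleftrightarrow> U \<subseteq> circle \<and> open (frac -` U)"
proof -
  have "istopology (\<lambda>U. U \<subseteq> circle \<and> open (frac -` U))"
    unfolding istopology_def by (auto simp: vimage_Union)
  then show ?thesis
    by (simp add: circle_topology_def)
qed

lemma topspace_circle_topology [simp]: "topspace circle_topology = circle"
proof -
  have "frac -` circle = UNIV"
    by auto
  then have "openin circle_topology circle"
    by (simp add: openin_circle_topology)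
  then show ?thesis
    by (metis openin_circle_topology openin_subset openin_topspace subset_antisym)
qed

lemma quotient_map_frac: "quotient_map euclidean circle_topology frac"
proof -
  have "range frac = circle"
  proof
    show "circle \<subseteq> range frac"
      by (metis circle_def frac_eq_id rangeI subsetI)
  qed auto
  moreover have "{x. frac x \<in> U} = frac -` U" for U :: "real set"
    by auto
  ultimately show ?thesis
    by (simp add: quotient_map_def openin_circle_topology)
qed


section \<open>Orientation-preserving homeomorphisms and their lifts\<close>

definition line_homeos :: "(real \<Rightarrow> real) set" where
  "line_homeos = {F. homeomorphic_map euclidean euclidean F \<and> strict_mono F \<and>
                     (\<forall>x. F (x + 1) = F x + 1)}"

definition is_lift :: "(real \<Rightarrow> real) \<Rightarrow> (real \<Rightarrow> real) \<Rightarrow> bool" where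
  "is_lift F f \<longleftrightarrow> F \<in> line_homeos \<and> frac \<circ> F = f \<circ> frac"

text \<open>
  Self-maps of the circle are functions on the reals that take the value \<^const>\<open>undefined\<close>
  outside \<open>[0,1)\<close>, so that equality of functions is equality of circle maps.
\<close>

definition circle_homeos :: "(real \<Rightarrow> real) set" where
  "circle_homeos = {f \<in> circle \<rightarrow>\<^sub>E circle.
     homeomorphic_map circle_topology circle_topology f \<and> (\<exists>F. is_lift F f)}"

definition displacement_norm :: "(real \<Rightarrow> real) \<Rightarrow> real" where
  "displacement_norm F = (SUP x. \<bar>F x - x\<bar>)"

text \<open>
  Outside the relevant sets of homeomorphisms the two distances are set to 0, because
  \<^locale>\<open>Metric_space\<close> demands nonnegativity and symmetry everywhere.
\<close>

definition line_dist :: "(real \<Rightarrow> real) \<Rightarrow> (real \<Rightarrow> real) \<Rightarrow> real" where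
  "line_dist F G =
     (if F \<in> line_homeos \<and> G \<in> line_homeos then SUP x. \<bar>F x - G x\<bar> else 0)"

definition circle_dist :: "(real \<Rightarrow> real) \<Rightarrow> (real \<Rightarrow> real) \<Rightarrow> real" where
  "circle_dist f g =
     (if f \<in> circle_homeos \<and> g \<in> circle_homeos
      then Inf {line_dist F G | F G. is_lift F f \<and> is_lift G g} else 0)"

lemma line_homeos_continuous:
  assumes "F \<in> line_homeos"
  shows "continuous_on UNIV F"
  using assms homeomorphic_imp_continuous_map[of euclidean euclidean F]
  by (simp add: line_homeos_def)

lemma line_homeos_add_nat:
  assumes "F \<in> line_homeos"
  shows "F (x + real n) = F x + real n"
proof (induction n)
  case (Suc n)
  have "F (x + real (Suc n)) = F ((x + real n) + 1)"
    by (simp add: algebra_simps)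
  also have "\<dots> = F (x + real n) + 1"
    using assms by (simp add: line_homeos_def)
  finally show ?case
    using Suc by simp
qed simp

lemma line_homeos_add_int:
  assumes "F \<in> line_homeos"
  shows "F (x + of_int k) = F x + of_int k"
proof (cases "k \<ge> 0")
  case True
  then show ?thesis
    using line_homeos_add_nat[OF assms, of x "nat k"] by simp
next
  case False
  then show ?thesis
    using line_homeos_add_nat[OF assms, of "x + of_int k" "nat (- k)"] by simp
qed

lemma displacement_bounded:
  assumes "F \<in> line_homeos"
  shows "\<bar>F x - x\<bar> \<le> \<bar>F 0\<bar> + 1"
proof -
  define r where "r = frac x"
  have r: "0 \<le> r" "r < 1" and x: "x = r + of_int \<lfloor>x\<rfloor>"
    by (auto simp: r_def frac_lt_1) (simp add: frac_def)
  have "F x = F r + of_int \<lfloor>x\<rfloor>"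
    using line_homeos_add_int[OF assms, of r "\<lfloor>x\<rfloor>"] x by simp
  then have eq: "F x - x = F r - r"
    using x by simp
  have mono: "mono F"
    using assms by (auto simp: line_homeos_def strict_mono_mono)
  have "F 0 \<le> F r" "F r \<le> F 1"
    using r mono by (auto simp: mono_def)
  moreover have "F 1 = F 0 + 1"
    using line_homeos_add_nat[OF assms, of 0 1] by simp
  ultimately show ?thesis
    using eq r by linarith
qed

lemma line_dist_bdd:
  assumes "F \<in> line_homeos" "G \<in> line_homeos"
  shows "bdd_above (range (\<lambda>x. \<bar>F x - G x\<bar>))"
proof (rule bdd_aboveI2)
  fix x
  show "\<bar>F x - G x\<bar> \<le> \<bar>F 0\<bar> + \<bar>G 0\<bar> + 2"
    using displacement_bounded[OF assms(1), of x] displacement_bounded[OF assms(2), of x]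
    by linarith
qed

lemma line_dist_upper:
  assumes "F \<in> line_homeos" "G \<in> line_homeos"
  shows "\<bar>F x - G x\<bar> \<le> line_dist F G"
  using cSUP_upper[OF _ line_dist_bdd[OF assms], of x] assms by (simp add: line_dist_def)

lemma line_dist_least:
  assumes "F \<in> line_homeos" "G \<in> line_homeos" "\<And>x. \<bar>F x - G x\<bar> \<le> c"
  shows "line_dist F G \<le> c"
  using assms by (auto simp: line_dist_def intro: cSUP_least)

lemma line_dist_nonneg: "0 \<le> line_dist F G"
proof (cases "F \<in> line_homeos \<and> G \<in> line_homeos")
  case True
  then show ?thesis
    using line_dist_upper[of F G 0] by linarith
qed (auto simp: line_dist_def)

lemma line_dist_commute: "line_dist F G = line_dist G F"
  by (simp add: line_dist_def abs_minus_commute conj_commute)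

interpretation line: Metric_space line_homeos line_dist
proof
  fix F G K assume FGK: "F \<in> line_homeos" "G \<in> line_homeos" "K \<in> line_homeos"
  show "line_dist F K \<le> line_dist F G + line_dist G K"
  proof (rule line_dist_least)
    fix x
    show "\<bar>F x - K x\<bar> \<le> line_dist F G + line_dist G K"
      using line_dist_upper[of F G x] line_dist_upper[of G K x] FGK by linarith
  qed (use FGK in auto)
next
  fix F G assume FG: "F \<in> line_homeos" "G \<in> line_homeos"
  show "line_dist F G = 0 \<longleftrightarrow> F = G"
  proof
    assume "line_dist F G = 0"
    then have "F x = G x" for x
      using line_dist_upper[OF FG, of x] by simp
    then show "F = G"
      by auto
  next
    assume "F = G"
    then show "line_dist F G = 0"
      using FG by (simp add: line_dist_def)
  qed
qed (rule line_dist_nonneg line_dist_commute)+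

lemma lift_shift:
  assumes "is_lift F f"
  shows "is_lift (\<lambda>x. F x + of_int k) f"
proof -
  have F: "F \<in> line_homeos"
    using assms by (simp add: is_lift_def)
  have hom: "homeomorphic_map euclidean euclidean (\<lambda>x::real. x + of_int k)"
    unfolding homeomorphic_map_maps homeomorphic_maps_def
    by (intro exI[of _ "\<lambda>x. x - of_int k"]) (auto intro!: continuous_intros)
  have "homeomorphic_map euclidean euclidean (\<lambda>x. F x + of_int k)"
    using homeomorphic_map_compose[OF _ hom, of euclidean F] F
    by (simp add: line_homeos_def o_def)
  moreover have "strict_mono (\<lambda>x. F x + of_int k)"
    using F by (simp add: line_homeos_def strict_mono_def)
  ultimately have "(\<lambda>x. F x + of_int k) \<in> line_homeos"
    using F by (simp add: line_homeos_def)
  moreover have "frac (y + of_int k) = frac y" for y :: real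
    by (simp add: frac_def)
  ultimately show ?thesis
    using assms by (simp add: is_lift_def fun_eq_iff)
qed

lemma lift_unique:
  assumes "is_lift F f" "is_lift G f"
  obtains k :: int where "\<And>x. G x = F x + of_int k"
proof -
  define h where "h x = G x - F x" for x
  have int: "h x \<in> \<int>" for x
  proof -
    have "frac (G x) = frac (F x)"
      using assms by (simp add: is_lift_def fun_eq_iff)
    then have "h x = of_int \<lfloor>G x\<rfloor> - of_int \<lfloor>F x\<rfloor>"
      by (simp add: h_def frac_def)
    then show ?thesis
      by simp
  qed
  have "h constant_on UNIV"
  proof (rule continuous_discrete_range_constant)
    show "continuous_on UNIV h"
      unfolding h_def using assms
      by (intro continuous_intros line_homeos_continuous) (auto simp: is_lift_def)
    fix x
    have "1 \<le> norm (h y - h x)" if "h y \<noteq> h x" for y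
      using Ints_nonzero_abs_ge1[of "h y - h x"] int that by simp
    then show "\<exists>e>0. \<forall>y. y \<in> UNIV \<and> h y \<noteq> h x \<longrightarrow> e \<le> norm (h y - h x)"
      by (intro exI[of _ 1]) auto
  qed simp
  then obtain c where c: "\<And>x. h x = c"
    by (auto simp: constant_on_def)
  with int obtain k where "c = of_int k"
    by (metis Ints_cases)
  with c have "\<And>x. G x = F x + of_int k"
    by (simp add: h_def algebra_simps)
  then show ?thesis
    by (rule that)
qed

lemma circle_dist_le:
  assumes "f \<in> circle_homeos" "g \<in> circle_homeos" "is_lift F f" "is_lift G g"
  shows "circle_dist f g \<le> line_dist F G"
proof -
  have "Inf {line_dist F G | F G. is_lift F f \<and> is_lift G g} \<le> line_dist F G"
    by (rule cInf_lower) (use assms line_dist_nonneg in \<open>auto intro!: bdd_belowI[of _ 0]\<close>)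
  then show ?thesis
    using assms by (simp add: circle_dist_def)
qed

lemma circle_dist_greatest:
  assumes "f \<in> circle_homeos" "g \<in> circle_homeos"
    and "\<And>F G. is_lift F f \<Longrightarrow> is_lift G g \<Longrightarrow> c \<le> line_dist F G"
  shows "c \<le> circle_dist f g"
proof -
  have "c \<le> Inf {line_dist F G | F G. is_lift F f \<and> is_lift G g}"
    by (rule cInf_greatest) (use assms in \<open>auto simp: circle_homeos_def\<close>)
  then show ?thesis
    using assms by (simp add: circle_dist_def)
qed

interpretation circle: Metric_space circle_homeos circle_dist
proof
  fix f g
  show "0 \<le> circle_dist f g"
    using circle_dist_greatest[of f g 0] line_dist_nonneg
    by (cases "f \<in> circle_homeos \<and> g \<in> circle_homeos") (auto simp: circle_dist_def)
  have "{line_dist F G | F G. is_lift F f \<and> is_lift G g} =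
        {line_dist F G | F G. is_lift F g \<and> is_lift G f}"
    using line_dist_commute by (auto; metis)
  then show "circle_dist f g = circle_dist g f"
    by (simp add: circle_dist_def conj_commute)
next
  fix f g assume fg: "f \<in> circle_homeos" "g \<in> circle_homeos"
  then obtain F G where FG: "is_lift F f" "is_lift G g"
    by (auto simp: circle_homeos_def)
  then have FG': "F \<in> line_homeos" "G \<in> line_homeos"
    by (auto simp: is_lift_def)
  show "circle_dist f g = 0 \<longleftrightarrow> f = g"
  proof
    assume "f = g"
    have "0 \<le> circle_dist f f"
      using circle_dist_greatest[OF fg(1) fg(1), of 0] line_dist_nonneg by auto
    moreover have "circle_dist f f \<le> 0"
      using circle_dist_le[OF fg(1) fg(1) FG(1) FG(1)] FG' by simp
    ultimately show "circle_dist f g = 0"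
      using \<open>f = g\<close> by simp
  next
    assume 0: "circle_dist f g = 0"
    have "f x = g x" if x: "x \<in> circle" for x
    proof (rule ccontr)
      assume neq: "f x \<noteq> g x"
      define t where "t = F x - G x"
      have frac: "frac x = x"
        using x by (simp add: circle_def)
      have fx: "f x = frac (F x)" "g x = frac (G x)"
        using FG frac by (auto simp: is_lift_def fun_eq_iff)
      have "t \<notin> \<int>"
      proof
        assume "t \<in> \<int>"
        then obtain k where "F x = G x + of_int k"
          by (auto simp: t_def Ints_def algebra_simps)
        then have "frac (F x) = frac (G x)"
          by (simp add: frac_def)
        with fx neq show False by simp
      qed
      define e where "e = min (frac t) (1 - frac t)"
      have e: "0 < e"
        using \<open>t \<notin> \<int>\<close> by (simp add: e_def frac_gt_0_iff frac_lt_1)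
      have far: "e \<le> \<bar>t + of_int k\<bar>" for k
      proof -
        define m where "m = \<lfloor>t\<rfloor> + k"
        have tk: "t + of_int k = frac t + of_int m"
          by (simp add: m_def frac_def)
        show ?thesis
        proof (cases "m \<ge> 0")
          case True
          then have "0 \<le> (of_int m :: real)" by simp
          with tk show ?thesis
            unfolding e_def by linarith
        next
          case False
          then have "(of_int m :: real) \<le> -1" by linarith
          with tk show ?thesis
            unfolding e_def by linarith
        qed
      qed
      have "e \<le> circle_dist f g"
      proof (rule circle_dist_greatest[OF fg])
        fix F' G' assume l: "is_lift F' f" "is_lift G' g"
        obtain i where i: "\<And>x. F' x = F x + of_int i"
          using lift_unique[OF FG(1) l(1)] by metis
        obtain j where j: "\<And>x. G' x = G x + of_int j"
          using lift_unique[OF FG(2) l(2)] by metis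
        have "e \<le> \<bar>F' x - G' x\<bar>"
          using far[of "i - j"] by (simp add: i j t_def algebra_simps)
        also have "\<dots> \<le> line_dist F' G'"
          using l by (intro line_dist_upper) (auto simp: is_lift_def)
        finally show "e \<le> line_dist F' G'" .
      qed
      with 0 e show False by simp
    qed
    then show "f = g"
      using fg by (intro PiE_ext[of f circle _ g]) (auto simp: circle_homeos_def)
  qed
next
  fix f g h assume fgh: "f \<in> circle_homeos" "g \<in> circle_homeos" "h \<in> circle_homeos"
  have *: "circle_dist f h \<le> line_dist F G + line_dist G' K"
    if l: "is_lift F f" "is_lift G g" "is_lift G' g" "is_lift K h" for F G G' K
  proof -
    obtain k where k: "\<And>x. G x = G' x + of_int k"
      using lift_unique[OF l(3) l(2)] by metis
    define K' where "K' = (\<lambda>x. K x + of_int k)"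
    have K': "is_lift K' h"
      unfolding K'_def by (rule lift_shift[OF l(4)])
    have mem: "F \<in> line_homeos" "G \<in> line_homeos" "G' \<in> line_homeos"
      "K \<in> line_homeos" "K' \<in> line_homeos"
      using l K' by (auto simp: is_lift_def)
    have "line_dist G K' = line_dist G' K"
      using mem by (simp add: line_dist_def k K'_def)
    then show ?thesis
      using circle_dist_le[OF fgh(1) fgh(3) l(1) K'] line.triangle[OF mem(1,2,5)] by simp
  qed
  have "circle_dist f h - circle_dist f g \<le> circle_dist g h"
  proof (rule circle_dist_greatest[OF fgh(2,3)])
    fix G' K assume l: "is_lift G' g" "is_lift K h"
    have "circle_dist f h - line_dist G' K \<le> circle_dist f g"
      by (rule circle_dist_greatest[OF fgh(1,2)]) (use * l in force)
    then show "circle_dist f h - circle_dist f g \<le> line_dist G' K"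
      by simp
  qed
  then show "circle_dist f h \<le> circle_dist f g + circle_dist g h"
    by simp
qed

definition line_homeos_borel :: "(real \<Rightarrow> real) measure" where
  "line_homeos_borel = sigma line_homeos {U. openin line.mtopology U}"

definition circle_homeos_borel :: "(real \<Rightarrow> real) measure" where
  "circle_homeos_borel = sigma circle_homeos {U. openin circle.mtopology U}"


section \<open>Random circle homeomorphisms\<close>

locale measure_preserving_system = prob_space M for M :: "'a measure" +
  fixes \<sigma> :: "'a \<Rightarrow> 'a"
  assumes measurable_shift: "\<sigma> \<in> M \<rightarrow>\<^sub>M M"
    and measure_preserving: "\<And>A. A \<in> sets M \<Longrightarrow> measure M (\<sigma> -` A \<inter> space M) = measure M A"

definition random_circle_homeos :: "'a measure \<Rightarrow> ('a \<Rightarrow> real \<Rightarrow> real) set" where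
  "random_circle_homeos M = M \<rightarrow>\<^sub>M circle_homeos_borel"

definition random_line_homeos :: "'a measure \<Rightarrow> ('a \<Rightarrow> real \<Rightarrow> real) set" where
  "random_line_homeos M =
     {F \<in> M \<rightarrow>\<^sub>M line_homeos_borel. integrable M (\<lambda>\<omega>. displacement_norm (F \<omega>))}"

definition is_random_lift ::
  "'a measure \<Rightarrow> ('a \<Rightarrow> real \<Rightarrow> real) \<Rightarrow> ('a \<Rightarrow> real \<Rightarrow> real) \<Rightarrow> bool" where
  "is_random_lift M F f \<longleftrightarrow>
     F \<in> M \<rightarrow>\<^sub>M line_homeos_borel \<and> (\<forall>\<omega>\<in>space M. is_lift (F \<omega>) (f \<omega>))"

definition is_standard_lift ::
  "'a measure \<Rightarrow> ('a \<Rightarrow> real \<Rightarrow> real) \<Rightarrow> ('a \<Rightarrow> real \<Rightarrow> real) \<Rightarrow> bool" where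
  "is_standard_lift M F f \<longleftrightarrow> is_random_lift M F f \<and> (\<forall>\<omega>\<in>space M. F \<omega> 0 \<in> {0..<1})"

text \<open>
  The iterate \<open>f\<^sub>\<omega>\<^sup>(\<^sup>n\<^sup>)\<close>, used both on the line and on the circle. On the circle only
  its values at points of \<open>[0,1)\<close> are meaningful.
\<close>

primrec random_iterate ::
  "('a \<Rightarrow> 'a) \<Rightarrow> ('a \<Rightarrow> 'b \<Rightarrow> 'b) \<Rightarrow> nat \<Rightarrow> 'a \<Rightarrow> 'b \<Rightarrow> 'b" where
  "random_iterate \<sigma> f 0 \<omega> = id"
| "random_iterate \<sigma> f (Suc n) \<omega> = f ((\<sigma> ^^ n) \<omega>) \<circ> random_iterate \<sigma> f n \<omega>"

text \<open>
  \<open>\<rho>\<close> is a version of the random rotation number of \<open>F\<close>, which is determined by this property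
  up to a null set. The exceptional null set in the limit may depend on \<open>x\<close>.
\<close>

definition is_random_rotation_number ::
  "'a measure \<Rightarrow> ('a \<Rightarrow> 'a) \<Rightarrow> ('a \<Rightarrow> real \<Rightarrow> real) \<Rightarrow> ('a \<Rightarrow> real) \<Rightarrow> bool" where
  "is_random_rotation_number M \<sigma> F \<rho> \<longleftrightarrow> integrable M \<rho> \<and>
     (\<forall>x. AE \<omega> in M. (\<lambda>n. (random_iterate \<sigma> F n \<omega> x - x) / real n) \<longlonglongrightarrow> \<rho> \<omega>)"


section \<open>Binary coding frequency\<close>

definition coding_interval :: "('a \<Rightarrow> real \<Rightarrow> real) \<Rightarrow> 'a \<Rightarrow> real set" where
  "coding_interval f \<omega> = (if f \<omega> 0 \<noteq> 0 then {inv_into circle (f \<omega>) 0..<1} else {})"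

definition binary_frequency ::
  "('a \<Rightarrow> 'a) \<Rightarrow> ('a \<Rightarrow> real \<Rightarrow> real) \<Rightarrow> nat \<Rightarrow> 'a \<Rightarrow> real \<Rightarrow> real" where
  "binary_frequency \<sigma> f n \<omega> x\<^sub>0 =
     1 / real n * (\<Sum>k<n. indicator (coding_interval f ((\<sigma> ^^ k) \<omega>)) (random_iterate \<sigma> f k \<omega> x\<^sub>0))"

end

theory Submission
  imports Defs
begin

text \<open>
  Write \<open>F\<^sub>\<omega>\<^sup>(\<^sup>k\<^sup>)(x\<^sub>0) = y\<^sub>k + m\<^sub>k\<close> with \<open>y\<^sub>k \<in> [0,1)\<close> and \<open>m\<^sub>k\<close> an integer. Then
  \<open>y\<^sub>k\<close> is the orbit of \<open>x\<^sub>0\<close> on the circle, and \<open>m\<^sub>k\<close> grows by the integer part of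
  \<open>F(y\<^sub>k)\<close> for the lift \<open>F\<close> at time \<open>k\<close>. As \<open>F(0) \<in> [0,1)\<close>, this increment is 0 or 1,
  and it is 1 exactly when \<open>y\<^sub>k\<close> lies in the coding interval. So \<open>n B\<^sub>f(n, \<omega>, x\<^sub>0)\<close> is the
  integer part of \<open>F\<^sub>\<omega>\<^sup>(\<^sup>n\<^sup>)(x\<^sub>0)\<close>.
\<close>

lemma is_lift_frac:
  assumes "is_lift F f"
  shows "frac (F x) = f (frac x)"
  using assms by (simp add: is_lift_def fun_eq_iff)

lemma is_lift_strict_mono:
  assumes "is_lift F f"
  shows "strict_mono F"
  using assms by (simp add: is_lift_def line_homeos_def)

lemma is_lift_in_Ints_iff:
  assumes "is_lift F f" and "x \<in> circle"
  shows "F x \<in> \<int> \<longleftrightarrow> f x = 0"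
  using is_lift_frac[OF assms(1), of x] assms(2)
  by (simp add: circle_def frac_eq_0_iff [symmetric])

text \<open>Ensures that \<open>inv_into circle (f \<omega>) 0\<close> really is a preimage of 0,
  and not an arbitrary value. Surjectivity is inherited from the lift.\<close>

lemma is_lift_surj_on_circle:
  assumes "is_lift F f"
  shows "f ` circle = circle"
proof (intro equalityI subsetI)
  fix y assume "y \<in> f ` circle"
  then obtain x where "x \<in> circle" "y = f x"
    by auto
  then show "y \<in> circle"
    using is_lift_frac[OF assms, of x] by (metis circle_def frac_eq_id frac_in_circle)
next
  fix y assume y: "y \<in> circle"
  have "homeomorphic_map euclidean euclidean F"
    using assms by (simp add: is_lift_def line_homeos_def)
  then have "surj F"
    using homeomorphic_imp_surjective_map by fastforce
  then obtain x where "y = F x"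
    by (metis surjE)
  then have "f (frac x) = y"
    using is_lift_frac[OF assms, of x] y by (simp add: circle_def)
  then show "y \<in> f ` circle"
    by (metis frac_in_circle imageI)
qed

text \<open>By monotonicity the lift sends [0,1) into [F(0), F(0) + 1), a subset of [0,2). The floor
  can therefore change only where the lift crosses 1, and that point is the preimage of 0 under the
  circle map.\<close>

lemma floor_standard_lift:
  assumes lift: "is_lift (F \<omega>) (f \<omega>)" and F0: "F \<omega> 0 \<in> {0..<1}" and x: "x \<in> circle"
  shows "of_int \<lfloor>F \<omega> x\<rfloor> = (indicator (coding_interval f \<omega>) x :: real)"
proof -
  have mono: "F \<omega> a < F \<omega> b \<longleftrightarrow> a < b" for a b
    by (rule strict_mono_less[OF is_lift_strict_mono[OF lift]])
  have F1: "F \<omega> 1 = F \<omega> 0 + 1"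
    using line_homeos_add_nat[of "F \<omega>" 0 1] lift by (simp add: is_lift_def)
  have bounds: "F \<omega> 0 \<le> F \<omega> y" "F \<omega> y < F \<omega> 0 + 1" if "y \<in> circle" for y
    using that mono[of y 0] mono[of y 1] F1 by (auto simp: circle_def)
  have f0: "f \<omega> 0 = F \<omega> 0"
    using is_lift_frac[OF lift, of 0] F0 by simp
  show ?thesis
  proof (cases "f \<omega> 0 = 0")
    \<comment> \<open>Here F(0) = 0, so the lift maps [0,1) into itself and never reaches 1.\<close>
    case True
    then have "\<lfloor>F \<omega> x\<rfloor> = 0"
      using bounds[OF x] f0 by (simp add: floor_eq_iff)
    then show ?thesis
      using True by (simp add: coding_interval_def)
  next
    case False
    define c where "c = inv_into circle (f \<omega>) 0"
    have "0 \<in> f \<omega> ` circle"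
      unfolding is_lift_surj_on_circle[OF lift] by (simp add: circle_def)
    then have c: "c \<in> circle" "f \<omega> c = 0"
      by (simp_all add: c_def inv_into_into f_inv_into_f)
    then obtain k where k: "F \<omega> c = of_int k"
      using is_lift_in_Ints_iff[OF lift c(1)] by (auto elim: Ints_cases)
    \<comment> \<open>Strict positivity excludes k = 0; the upper bound F(0) + 1 < 2 leaves only k =
      1.\<close>
    have "0 < F \<omega> 0"
      using F0 False f0 by simp
    then have "(0::real) < of_int k" "(of_int k :: real) < 2"
      using bounds[OF c(1)] F0 k by auto
    then have "k = 1"
      by linarith
    then have "x < c \<longleftrightarrow> F \<omega> x < 1"
      using mono[of x c] k by simp
    then have "\<lfloor>F \<omega> x\<rfloor> = (if x < c then 0 else 1)"
      using bounds[OF x] F0 by (auto simp: floor_eq_iff)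
    then show ?thesis
      using False x by (auto simp: coding_interval_def c_def circle_def indicator_def)
  qed
qed

text \<open>The two claims go through one induction: the floor increment at time n is governed by
  the circle orbit, which the second claim identifies with the fractional part.\<close>

lemma random_iterate_lift_decomp:
  assumes "\<And>k. is_lift (F ((\<sigma> ^^ k) \<omega>)) (f ((\<sigma> ^^ k) \<omega>))"
    and "\<And>k. F ((\<sigma> ^^ k) \<omega>) 0 \<in> {0..<1}" and "x \<in> circle"
  shows "of_int \<lfloor>random_iterate \<sigma> F n \<omega> x\<rfloor> =
           (\<Sum>k<n. indicator (coding_interval f ((\<sigma> ^^ k) \<omega>)) (random_iterate \<sigma> f k \<omega> x) :: real)
       \<and> frac (random_iterate \<sigma> F n \<omega> x) = random_iterate \<sigma> f n \<omega> x"
proof (induction n)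
  case 0
  then show ?case
    using assms(3) by (simp add: circle_def floor_eq_iff)
next
  case (Suc n)
  define y where "y = random_iterate \<sigma> f n \<omega> x"
  define z where "z = random_iterate \<sigma> F n \<omega> x"
  define G where "G = F ((\<sigma> ^^ n) \<omega>)"
  have yz: "frac z = y"
    using Suc by (simp add: y_def z_def)
  then have y: "y \<in> circle"
    by (metis frac_in_circle)
  \<comment> \<open>Commuting with integer translations lets the integer part of z pass through G,
    so the floors add.\<close>
  have "z = y + of_int \<lfloor>z\<rfloor>"
    using yz by (simp add: frac_def)
  then have "G z = G y + of_int \<lfloor>z\<rfloor>"
    using line_homeos_add_int[of G y "\<lfloor>z\<rfloor>"] assms(1)[of n] by (simp add: is_lift_def G_def)
  then have "\<lfloor>G z\<rfloor> = \<lfloor>z\<rfloor> + \<lfloor>G y\<rfloor>"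
    by simp
  moreover have "frac (G z) = f ((\<sigma> ^^ n) \<omega>) y"
    using is_lift_frac[OF assms(1)[of n], of z] yz by (simp add: G_def)
  ultimately show ?case
    using Suc floor_standard_lift[of F "(\<sigma> ^^ n) \<omega>" f y, OF assms(1,2) y]
    by (metis (no_types, lifting) G_def comp_apply frac_in_circle of_int_add random_iterate.simps(2)
        sum.lessThan_Suc y_def z_def)
qed

theorem theorem2:
  fixes M :: "'a measure" and \<sigma> :: "'a \<Rightarrow> 'a"
    and f F :: "'a \<Rightarrow> real \<Rightarrow> real"
  assumes "measure_preserving_system M \<sigma>"
    and "f \<in> random_circle_homeos M"
    and "F \<in> random_line_homeos M"
    and "is_standard_lift M F f"
  shows "(\<forall>x\<^sub>0\<in>{0..<1}. \<forall>n::nat. \<forall>\<omega>\<in>space M. n \<ge> 1 \<longrightarrow>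
            \<bar>1 / real n * random_iterate \<sigma> F n \<omega> x\<^sub>0 - binary_frequency \<sigma> f n \<omega> x\<^sub>0\<bar> < 1 / real n)
       \<and> (\<forall>\<rho>. is_random_rotation_number M \<sigma> F \<rho> \<longrightarrow>
            (\<forall>x\<^sub>0\<in>{0..<1}. AE \<omega> in M.
              (\<lambda>n. binary_frequency \<sigma> f n \<omega> x\<^sub>0) \<longlonglongrightarrow> \<rho> \<omega>))"
proof -
  \<comment> \<open>The lift properties are given only on \<open>space M\<close>, so the orbit must
    stay there.\<close>
  have orbit: "(\<sigma> ^^ k) \<omega> \<in> space M" if "\<omega> \<in> space M" for k \<omega>
    using that measurable_space[OF measure_preserving_system.measurable_shift[OF assms(1)]]
    by (induction k) auto
  \<comment> \<open>The error is known exactly, and both claims follow from it. For n = 0 both sides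
    are 0, as division by zero yields 0.\<close>
  have diff: "1 / real n * random_iterate \<sigma> F n \<omega> x - binary_frequency \<sigma> f n \<omega> x =
      frac (random_iterate \<sigma> F n \<omega> x) / real n" if "x \<in> {0..<1}" "\<omega> \<in> space M" for x n \<omega>
  proof -
    have "is_lift (F ((\<sigma> ^^ k) \<omega>)) (f ((\<sigma> ^^ k) \<omega>))" "F ((\<sigma> ^^ k) \<omega>) 0 \<in> {0..<1}" for k
      using assms(4) orbit[OF that(2), of k] by (auto simp: is_standard_lift_def is_random_lift_def)
    then have "of_int \<lfloor>random_iterate \<sigma> F n \<omega> x\<rfloor> =
      (\<Sum>k<n. indicator (coding_interval f ((\<sigma> ^^ k) \<omega>)) (random_iterate \<sigma> f k \<omega> x) :: real)"
      using random_iterate_lift_decomp[of F \<sigma> \<omega> f x n] that(1) by (simp add: circle_def)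
    then show ?thesis
      by (simp add: binary_frequency_def frac_def diff_divide_distrib)
  qed
  have conv: "(\<lambda>n. binary_frequency \<sigma> f n \<omega> x) \<longlonglongrightarrow> r"
    if x: "x \<in> {0..<1}" and \<omega>: "\<omega> \<in> space M"
      and lim: "(\<lambda>n. (random_iterate \<sigma> F n \<omega> x - x) / real n) \<longlonglongrightarrow> r" for x \<omega> r
  proof -
    \<comment> \<open>This correction turns the rotation quotient into the coding frequency; its
      numerator is bounded by 1.\<close>
    have "(\<lambda>n. (x - frac (random_iterate \<sigma> F n \<omega> x)) / real n) \<longlonglongrightarrow> 0"
    proof (rule Lim_null_comparison[OF _ lim_1_over_n])
      have "\<bar>x - frac t\<bar> \<le> 1" for t
        using x frac_ge_0[of t] frac_lt_1[of t] unfolding atLeastLessThan_iff by linarith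
      then show "\<forall>\<^sub>F n in sequentially. norm ((x - frac (random_iterate \<sigma> F n \<omega> x)) / real n)
          \<le> 1 / of_nat n"
        by (simp add: divide_right_mono)
    qed
    with lim have "(\<lambda>n. (random_iterate \<sigma> F n \<omega> x - x) / real n
        + (x - frac (random_iterate \<sigma> F n \<omega> x)) / real n) \<longlonglongrightarrow> r + 0"
      by (rule tendsto_add)
    moreover have "binary_frequency \<sigma> f n \<omega> x = (random_iterate \<sigma> F n \<omega> x - x) / real n
        + (x - frac (random_iterate \<sigma> F n \<omega> x)) / real n" for n
      using diff[OF x \<omega>, of n] by (simp add: diff_divide_distrib)
    ultimately show ?thesis
      by simp
  qed
  show ?thesis
  proof (intro conjI ballI allI impI)
    fix x :: real and n :: nat and \<omega>
    assume "x \<in> {0..<1}" "\<omega> \<in> space M" "n \<ge> 1"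
    then show "\<bar>1 / real n * random_iterate \<sigma> F n \<omega> x - binary_frequency \<sigma> f n \<omega> x\<bar> < 1 / real n"
      unfolding diff[OF \<open>x \<in> {0..<1}\<close> \<open>\<omega> \<in> space M\<close>]
      by (simp add: frac_lt_1 divide_strict_right_mono)
  next
    fix \<rho> :: "'a \<Rightarrow> real" and x :: real
    assume "is_random_rotation_number M \<sigma> F \<rho>" and x: "x \<in> {0..<1}"
    then have "AE \<omega> in M. (\<lambda>n. (random_iterate \<sigma> F n \<omega> x - x) / real n) \<longlonglongrightarrow> \<rho> \<omega>"
      by (simp add: is_random_rotation_number_def)
    \<comment> \<open>Since \<open>conv\<close> holds pointwise in \<omega>, the exceptional null
      set is the one for the rotation limit at the same x.\<close>
    then show "AE \<omega> in M. (\<lambda>n. binary_frequency \<sigma> f n \<omega> x) \<longlonglongrightarrow> \<rho> \<omega>"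
      by (rule AE_mp) (use conv[OF x] in \<open>auto intro: AE_I2\<close>)
  qed
qed

end
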